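(* Let $\mu$ be a centered probability measure on $\mathbb{R}$, absolutely continuous with respect to the Lebesgue measure and supported on a compact interval. Let $u$ be the free moment map of $\mu$, i.e. $\mu=(u')_{\sharp}\nu_u$, where $\nu_u$ is the free Gibbs measure associated with $u$. If $u$ is $\mathcal{C}^2$ and strictly convex on $\mathbb{R}$, then, with $u^*$ the Legendre transform of $u$ (so that $(u^* )'=(u')^{-1}$), the function $$(x,y)\mapsto \big(\mathscr{J}(u^* )'(x,y)\big)^{-1}=\mathscr{J}u'\big((u^* )'(x),(u^* )'(y)\big)=\frac{x-y}{(u^* )'(x)-(u^* )'(y)}=\frac{x-y}{(u')^{-1}(x)-(u')^{-1}(y)}$$ is a free Stein kernel for $\mu$ with respect to the standard semicircular potential $\tfrac12 x^2$.
   Context: For a function $f$ on $\mathbb{R}$, the free difference quotient is $\mathscr{J}f(x,y)=\frac{f(x)-f(y)}{x-y}$ if $x\neq y$ and $\mathscr{J}f(x,x)=f'(x)$. Free Gibbs measure: for a convex function $u:\mathbb{R}\to\mathbb{R}$, the free Gibbs measure $\nu_u$ is the unique minimizer, over Borel probability measures $\rho$ on $\mathbb{R}$, of $-\iint\log|t-s|\,d\rho(t)\,d\rho(s)+\int u(s)\,d\rho(s)$. Free moment map: for a centered probability measure $\mu\neq\delta_0$ on $\mathbb{R}$ with finite second moment, the free moment map of $\mu$ is the convex lower semicontinuous function $u$ such that $\mu$ is the pushforward $(u')_\sharp\nu_u$ of the free Gibbs measure $\nu_u$ by $u'$. Free Stein kernel: a free Stein kernel of $\mu$ relative to a $\mathcal{C}^1$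 potential $v:\mathbb{R}\to\mathbb{R}$ is a function $A:\mathbb{R}^2\to\mathbb{R}$ such that for all smooth test functions $f$, $\int v'(x)f(x)\,d\mu(x)=\iint A(x,y)\,\mathscr{J}f(x,y)\,d\mu(x)\,d\mu(y)$. When $\mu$ is non-atomic the diagonal is $\mu\otimes\mu$-negligible, so $A$ need only be defined $\mu\otimes\mu$-almost everywhere. Legendre transform: $u^*(y)=\sup_x\{xy-u(x)\}$. *)

theory Defs
  imports "HOL-Probability.Probability"
begin

definition C_k :: "nat \<Rightarrow> (real \<Rightarrow> real) \<Rightarrow> bool" where
  "C_k k f \<longleftrightarrow> (\<forall>j<k. \<forall>x. (deriv ^^ j) f differentiable (at x))
      \<and> continuous_on UNIV ((deriv ^^ k) f)"

definition smooth_fun :: "(real \<Rightarrow> real) \<Rightarrow> bool" where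
  "smooth_fun f \<longleftrightarrow> (\<forall>k. C_k k f)"

definition strictly_convex :: "(real \<Rightarrow> real) \<Rightarrow> bool" where
  "strictly_convex f \<longleftrightarrow> (\<forall>x y t. x \<noteq> y \<and> 0 < t \<and> t < 1 \<longrightarrow>
      f ((1 - t) * x + t * y) < (1 - t) * f x + t * f y)"

definition lower_semicontinuous :: "(real \<Rightarrow> real) \<Rightarrow> bool" where
  "lower_semicontinuous f \<longleftrightarrow> (\<forall>c. closed {x. f x \<le> c})"

definition free_diff_quot :: "(real \<Rightarrow> real) \<Rightarrow> real \<Rightarrow> real \<Rightarrow> real" where
  "free_diff_quot f x y = (if x = y then deriv f x else (f x - f y) / (x - y))"

text \<open>
  Integral of an extended-real function as positive part minus negative part. In
  \<^typ>\<open>ereal\<close> both \<open>\<infinity> - \<infinity>\<close> and \<open>- \<infinity> + \<infinity>\<close> are \<open>\<infinity>\<close>, so measures for which the energy below is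
  indeterminate count as having infinite energy.
\<close>

definition ext_integral :: "'a measure \<Rightarrow> ('a \<Rightarrow> ereal) \<Rightarrow> ereal" where
  "ext_integral M f =
     enn2ereal (\<integral>\<^sup>+ x. e2ennreal (f x) \<partial>M) - enn2ereal (\<integral>\<^sup>+ x. e2ennreal (- f x) \<partial>M)"

text \<open>
  The diagonal is treated separately because \<open>ln 0 = 0\<close> in the library, whereas atoms must
  contribute infinite logarithmic energy.
\<close>

definition neg_log_dist :: "real \<Rightarrow> real \<Rightarrow> ereal" where
  "neg_log_dist t s = (if t = s then \<infinity> else ereal (- ln \<bar>t - s\<bar>))"

definition free_energy :: "(real \<Rightarrow> real) \<Rightarrow> real measure \<Rightarrow> ereal" where
  "free_energy u \<rho> =
     ext_integral (\<rho> \<Otimes>\<^sub>M \<rho>) (\<lambda>(t, s). neg_log_dist t s) + ext_integral \<rho> (\<lambda>s. ereal (u s))"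

definition borel_prob :: "real measure \<Rightarrow> bool" where
  "borel_prob \<rho> \<longleftrightarrow> prob_space \<rho> \<and> sets \<rho> = sets borel"

text \<open>The strict inequality expresses that \<open>\<nu>\<close> is the unique minimizer.\<close>

definition is_free_gibbs_measure :: "(real \<Rightarrow> real) \<Rightarrow> real measure \<Rightarrow> bool" where
  "is_free_gibbs_measure u \<nu> \<longleftrightarrow> borel_prob \<nu> \<and>
     (\<forall>\<rho>. borel_prob \<rho> \<and> \<rho> \<noteq> \<nu> \<longrightarrow> free_energy u \<nu> < free_energy u \<rho>)"

text \<open>
  A relation between \<open>\<mu>\<close> and \<open>u\<close>, since \<open>u\<close> can be determined only up to additive
  constants and translations of its argument.
\<close>

definition is_free_moment_map :: "real measure \<Rightarrow> (real \<Rightarrow> real) \<Rightarrow> bool" where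
  "is_free_moment_map \<mu> u \<longleftrightarrow> convex_on UNIV u \<and> lower_semicontinuous u \<and>
     (\<exists>\<nu>. is_free_gibbs_measure u \<nu> \<and> \<mu> = distr \<nu> borel (deriv u))"

definition legendre :: "(real \<Rightarrow> real) \<Rightarrow> real \<Rightarrow> ereal" where
  "legendre u y = (SUP x. ereal (x * y - u x))"

text \<open>Meaningful in the interior of the set where \<^term>\<open>legendre u\<close> is finite.\<close>

definition legendre_deriv :: "(real \<Rightarrow> real) \<Rightarrow> real \<Rightarrow> real" where
  "legendre_deriv u = deriv (\<lambda>y. real_of_ereal (legendre u y))"

text \<open>
  Using the completed product makes the notion depend only on the \<open>\<mu> \<otimes> \<mu>\<close>-almost everywhere
  class of \<open>A\<close>. Integrability is required explicitly because non-integrable functions have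
  integral \<open>0\<close> in the library. All smooth \<open>f\<close> are admitted as test functions; for compactly
  supported \<open>\<mu>\<close>, multiplying \<open>f\<close> by a cutoff shows that compactly supported smooth \<open>f\<close> give
  the same notion.
\<close>

definition is_free_stein_kernel ::
    "real measure \<Rightarrow> (real \<Rightarrow> real) \<Rightarrow> (real \<Rightarrow> real \<Rightarrow> real) \<Rightarrow> bool" where
  "is_free_stein_kernel \<mu> v A \<longleftrightarrow> C_k 1 v \<and>
     (\<forall>f. smooth_fun f \<longrightarrow>
        integrable \<mu> (\<lambda>x. deriv v x * f x) \<and>
        integrable (completion (\<mu> \<Otimes>\<^sub>M \<mu>)) (\<lambda>(x, y). A x y * free_diff_quot f x y) \<and>
        (\<integral>x. deriv v x * f x \<partial>\<mu>) =
          (\<integral>(x, y). A x y * free_diff_quot f x y \<partial>completion (\<mu> \<Otimes>\<^sub>M \<mu>)))"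

end

theory Submission
  imports Defs
begin

text \<open>
  The kernel identity is the first-order optimality condition for the free Gibbs measure \<open>\<nu>\<close>,
  read in the variable \<open>x = u' t\<close>. Moving \<open>\<nu>\<close> along \<open>id + \<epsilon> g\<close> replaces \<open>ln \<bar>t - s\<bar>\<close> by
  \<open>ln \<bar>t - s\<bar> + ln (1 + \<epsilon> \<cdot> (g t - g s) / (t - s))\<close> and \<open>u s\<close> by \<open>u (s + \<epsilon> g s)\<close>, so minimality of
  the energy in \<open>\<epsilon>\<close> gives the Schwinger-Dyson equation
  \<open>\<integral> u' g d\<nu> = \<integral>\<integral> (g t - g s) / (t - s) d\<nu> d\<nu>\<close>. For \<open>g = f \<circ> u'\<close> the left side is \<open>\<integral> x f x d\<mu>\<close>,
  and the integrand on the right factors as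
  \<open>(u' t - u' s) / (t - s)\<close> times the difference quotient of \<open>f\<close> at \<open>(u' t, u' s)\<close>; since \<open>u'\<close> is
  injective with inverse \<open>(u\<^sup>*)'\<close>, pushing forward by \<open>u'\<close> turns this into the kernel
  \<open>(x - y) / ((u\<^sup>*)' x - (u\<^sup>*)' y)\<close>.

  Three analytic points carry the argument. First, the energy of \<open>\<nu>\<close> must be an honest finite
  number (\<open>finite_free_energyD\<close>): because \<open>\<mu>\<close> is centered and has no atom at \<open>0\<close>, the derivative
  \<open>u'\<close> takes both signs, so \<open>u\<close> grows at least linearly (\<open>moment_map_linear_growth\<close>) and dominates
  the logarithm at infinity. Second, the perturbation argument (\<open>first_variation\<close>) is run only for
  compactly supported Lipschitz \<open>g\<close>, where every error term is bounded by a multiple of \<open>\<epsilon>\<^sup>2\<close>.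
  Third, one passes from truncations of \<open>f \<circ> u'\<close> to \<open>f \<circ> u'\<close> itself (\<open>schwinger_dyson\<close>). Since
  \<open>u'\<close> is monotone, its difference quotient is nonnegative; the truncated equation for \<open>f = id\<close> and
  monotone convergence make it integrable, and a multiple of it then dominates the quotient of \<open>f \<circ> u'\<close> for every
  smooth \<open>f\<close>, because \<open>f\<close> is Lipschitz on the compact interval that carries \<open>\<mu>\<close>.
\<close>

section \<open>Product probability spaces\<close>

lemma (in prob_space) AE_pair_both:
  assumes "AE t in M. Q t"
  shows "AE z in M \<Otimes>\<^sub>M M. Q (fst z) \<and> Q (snd z)"
proof -
  interpret P: pair_prob_space M M ..
  from assms obtain N where N: "{x \<in> space M. \<not> Q x} \<subseteq> N" "N \<in> null_sets M"
    by (auto simp: eventually_ae_filter)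
  have [measurable]: "N \<in> sets M" using N by auto
  have nn: "AE x in M. x \<notin> N" using N(2) by (rule AE_not_in)
  have "AE z in M \<Otimes>\<^sub>M M. fst z \<notin> N \<and> snd z \<notin> N"
  proof (rule P.AE_pair_measure)
    show "AE x in M. AE y in M. fst (x, y) \<notin> N \<and> snd (x, y) \<notin> N"
      using nn by eventually_elim (use nn in eventually_elim, simp)
  qed measurable
  moreover have "AE z in M \<Otimes>\<^sub>M M. z \<in> space (M \<Otimes>\<^sub>M M)" by (rule AE_space)
  ultimately show ?thesis
    by eventually_elim (use N(1) in \<open>auto simp: space_pair_measure\<close>)
qed

lemma (in prob_space) integrable_pair_fst_snd:
  fixes f :: "'a \<Rightarrow> real"
  assumes "integrable M f"
  shows "integrable (M \<Otimes>\<^sub>M M) (\<lambda>z. f (fst z))" "integrable (M \<Otimes>\<^sub>M M) (\<lambda>z. f (snd z))"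
proof -
  interpret P: pair_prob_space M M ..
  have m[measurable]: "f \<in> borel_measurable M" using assms by auto
  show 1: "integrable (M \<Otimes>\<^sub>M M) (\<lambda>z. f (fst z))"
    by (rule P.Fubini_integrable) (use assms in \<open>auto simp: prob_space\<close>)
  show "integrable (M \<Otimes>\<^sub>M M) (\<lambda>z. f (snd z))"
    by (rule P.Fubini_integrable) (use assms in \<open>auto simp: prob_space\<close>)
qed

section \<open>Finite free energy\<close>

lemma ext_integral_ereal:
  assumes "integrable M f"
  shows "ext_integral M (\<lambda>x. ereal (f x)) = ereal (\<integral>x. f x \<partial>M)"
proof -
  have fin: "(\<integral>\<^sup>+x. ennreal (f x) \<partial>M) \<noteq> \<infinity>" "(\<integral>\<^sup>+x. ennreal (- f x) \<partial>M) \<noteq> \<infinity>"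
    using assms by (auto simp: real_integrable_def)
  have "enn2ereal p - enn2ereal n = ereal (enn2real p - enn2real n)"
    if "p \<noteq> \<infinity>" "n \<noteq> \<infinity>" for p n :: ennreal
    using that by (cases p; cases n) auto
  from this[OF fin] show ?thesis
    unfolding ext_integral_def real_lebesgue_integral_def[OF assms]
    by (simp add: e2ennreal_ereal)
qed

lemma ext_integral_cong_AE:
  assumes "AE x in M. f x = g x"
  shows "ext_integral M f = ext_integral M g"
proof -
  have "(\<integral>\<^sup>+ x. e2ennreal (f x) \<partial>M) = (\<integral>\<^sup>+ x. e2ennreal (g x) \<partial>M)"
    by (rule nn_integral_cong_AE) (use assms in eventually_elim, simp)
  moreover have "(\<integral>\<^sup>+ x. e2ennreal (- f x) \<partial>M) = (\<integral>\<^sup>+ x. e2ennreal (- g x) \<partial>M)"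
    by (rule nn_integral_cong_AE) (use assms in eventually_elim, simp)
  ultimately show ?thesis by (simp add: ext_integral_def)
qed

lemma free_energy_eq_real:
  assumes "AE (t, s) in \<rho> \<Otimes>\<^sub>M \<rho>. t \<noteq> s"
    and "integrable (\<rho> \<Otimes>\<^sub>M \<rho>) (\<lambda>(t, s). ln \<bar>t - s\<bar>)"
    and "integrable \<rho> u"
  shows "free_energy u \<rho> = ereal ((\<integral>s. u s \<partial>\<rho>) - (\<integral>(t, s). ln \<bar>t - s\<bar> \<partial>(\<rho> \<Otimes>\<^sub>M \<rho>)))"
proof -
  let ?P = "\<rho> \<Otimes>\<^sub>M \<rho>"
  have "ext_integral ?P (\<lambda>(t, s). neg_log_dist t s)
      = ext_integral ?P (\<lambda>z. ereal (- (case z of (t, s) \<Rightarrow> ln \<bar>t - s\<bar>)))"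
    by (rule ext_integral_cong_AE) (use assms(1) in eventually_elim, auto simp: neg_log_dist_def)
  also have "\<dots> = ereal (- (\<integral>(t, s). ln \<bar>t - s\<bar> \<partial>?P))"
    using assms(2) by (subst ext_integral_ereal) auto
  finally show ?thesis
    using ext_integral_ereal[OF assms(3)] by (simp add: free_energy_def)
qed

text \<open>A difference of extended reals whose first term is \<open>\<infinity>\<close> equals \<open>\<infinity>\<close>.\<close>

lemma ext_integral_posD:
  assumes "ext_integral M f \<noteq> \<infinity>"
  shows "(\<integral>\<^sup>+ x. e2ennreal (f x) \<partial>M) \<noteq> \<infinity>"
  using assms unfolding ext_integral_def
  by (metis enn2ereal_top infinity_ennreal_def minus_ereal_def plus_ereal.simps(2))

text \<open>
  Finiteness of the energy as an extended real only excludes \<open>\<infinity>\<close>, so a priori the logarithmic part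
  could be \<open>- \<infinity>\<close>. Linear growth of \<open>u\<close> excludes this: integrability of \<open>u\<close> yields a first
  moment, and \<open>ln \<bar>t - s\<bar> \<le> \<bar>t\<bar> + \<bar>s\<bar>\<close>.
\<close>

lemma finite_free_energyD:
  assumes "borel_prob \<rho>" "free_energy u \<rho> < \<infinity>"
    and u: "u \<in> borel_measurable borel"
    and c: "0 < c" and lin: "\<And>s. c * \<bar>s\<bar> - d \<le> u s"
  shows "AE (t, s) in \<rho> \<Otimes>\<^sub>M \<rho>. t \<noteq> s"
    and "integrable (\<rho> \<Otimes>\<^sub>M \<rho>) (\<lambda>(t, s). ln \<bar>t - s\<bar>)"
    and "integrable \<rho> u"
proof -
  interpret prob_space \<rho> using assms by (simp add: borel_prob_def)
  have sets[measurable_cong]: "sets \<rho> = sets borel" using assms by (simp add: borel_prob_def)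
  note u[measurable]
  let ?P = "\<rho> \<Otimes>\<^sub>M \<rho>"
  have E: "ext_integral ?P (\<lambda>(t, s). neg_log_dist t s) \<noteq> \<infinity>" "ext_integral \<rho> (\<lambda>s. ereal (u s)) \<noteq> \<infinity>"
    using assms(2) by (auto simp: free_energy_def)
  have up: "(\<integral>\<^sup>+ s. ennreal (u s) \<partial>\<rho>) \<noteq> \<infinity>"
    using ext_integral_posD[OF E(2)] by (simp add: e2ennreal_ereal)
  have "(\<integral>\<^sup>+ s. ennreal (- u s) \<partial>\<rho>) \<le> (\<integral>\<^sup>+ s. ennreal \<bar>d\<bar> \<partial>\<rho>)"
  proof (intro nn_integral_mono ennreal_leI)
    fix s
    have "0 \<le> c * \<bar>s\<bar>" using c by simp
    with lin[of s] show "- u s \<le> \<bar>d\<bar>" by linarith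
  qed
  also have "\<dots> < \<infinity>" by (simp add: emeasure_space_1)
  finally have um: "(\<integral>\<^sup>+ s. ennreal (- u s) \<partial>\<rho>) \<noteq> \<infinity>" by auto
  show intu: "integrable \<rho> u" using up um by (simp add: real_integrable_def)
  have intid: "integrable \<rho> (\<lambda>s. \<bar>s\<bar>)"
  proof (rule Bochner_Integration.integrable_bound)
    show "integrable \<rho> (\<lambda>s. (u s + d) / c)" using intu by auto
    have "\<bar>s\<bar> \<le> (u s + d) / c" for s using lin[of s] c by (simp add: field_simps)
    then show "AE s in \<rho>. norm \<bar>s\<bar> \<le> norm ((u s + d) / c)"
      by (intro AE_I2, unfold real_norm_def) (metis abs_idempotent abs_ge_self order_trans)
  qed measurable
  have pos: "(\<integral>\<^sup>+ z. e2ennreal (case z of (t, s) \<Rightarrow> neg_log_dist t s) \<partial>?P) \<noteq> \<infinity>"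
    by (rule ext_integral_posD[OF E(1)])
  have lm: "(\<lambda>(t, s). neg_log_dist t s) \<in> borel_measurable ?P"
    unfolding neg_log_dist_def by measurable
  have "AE z in ?P. e2ennreal (case z of (t, s) \<Rightarrow> neg_log_dist t s) \<noteq> \<infinity>"
    by (rule nn_integral_PInf_AE[OF _ pos]) (use lm in measurable)
  then show ne: "AE (t, s) in ?P. t \<noteq> s"
    by eventually_elim (auto simp: neg_log_dist_def)
  show "integrable ?P (\<lambda>(t, s). ln \<bar>t - s\<bar>)"
    unfolding real_integrable_def
  proof (intro conjI)
    have "(\<integral>\<^sup>+ z. ennreal (- (case z of (t, s) \<Rightarrow> ln \<bar>t - s\<bar>)) \<partial>?P)
       = (\<integral>\<^sup>+ z. e2ennreal (case z of (t, s) \<Rightarrow> neg_log_dist t s) \<partial>?P)"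
      by (rule nn_integral_cong_AE)
        (use ne in eventually_elim, auto simp: neg_log_dist_def e2ennreal_ereal)
    with pos show "(\<integral>\<^sup>+ z. ennreal (- (case z of (t, s) \<Rightarrow> ln \<bar>t - s\<bar>)) \<partial>?P) \<noteq> \<infinity>" by simp
    have "(\<integral>\<^sup>+ z. ennreal (case z of (t, s) \<Rightarrow> ln \<bar>t - s\<bar>) \<partial>?P)
        \<le> (\<integral>\<^sup>+ z. ennreal (\<bar>fst z\<bar> + \<bar>snd z\<bar>) \<partial>?P)"
    proof (intro nn_integral_mono ennreal_leI)
      fix z :: "real \<times> real"
      show "(case z of (t, s) \<Rightarrow> ln \<bar>t - s\<bar>) \<le> \<bar>fst z\<bar> + \<bar>snd z\<bar>"
      proof (cases "fst z = snd z")
        case False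
        then have "ln \<bar>fst z - snd z\<bar> < \<bar>fst z - snd z\<bar>" by (intro ln_less_self) simp
        then show ?thesis using abs_triangle_ineq4[of "fst z" "snd z"] by (simp add: split_beta)
      qed (simp add: split_beta)
    qed
    also have "\<dots> < \<infinity>"
      using Bochner_Integration.integrable_add[OF integrable_pair_fst_snd[OF intid]]
      by (simp add: integrable_iff_bounded)
    finally show "(\<integral>\<^sup>+ z. ennreal (case z of (t, s) \<Rightarrow> ln \<bar>t - s\<bar>) \<partial>?P) \<noteq> \<infinity>" by auto
  qed measurable
qed

section \<open>First variation of the free energy\<close>

text \<open>
  Stands in for differentiating the energy in \<open>e\<close>: a one-sided second-order bound on both sides of
  \<open>0\<close> already forces the first-order term to vanish.
\<close>

lemma zero_slope_of_quadratic_bound: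
  fixes D C e0 :: real
  assumes "0 < e0" and "\<And>e. \<bar>e\<bar> \<le> e0 \<Longrightarrow> 0 \<le> e * D + e\<^sup>2 * C"
  shows "D = 0"
proof (rule ccontr)
  assume "D \<noteq> 0"
  \<comment> \<open>So small that the quadratic term costs at most half of the linear gain.\<close>
  define e where "e = min e0 (\<bar>D\<bar> / (2 * (\<bar>C\<bar> + 1)))"
  have e: "0 < e" "e \<le> e0" using \<open>D \<noteq> 0\<close> assms(1) by (auto simp: e_def)
  have "e \<le> \<bar>D\<bar> / (2 * (\<bar>C\<bar> + 1))" by (simp add: e_def)
  then have "2 * (e * (\<bar>C\<bar> + 1)) \<le> \<bar>D\<bar>" by (simp add: field_simps)
  moreover have "0 \<le> (- sgn D * e) * D + (- sgn D * e)\<^sup>2 * C"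
    by (rule assms(2)) (use e in \<open>auto simp: abs_mult abs_sgn_eq\<close>)
  then have "0 \<le> e * (e * C - \<bar>D\<bar>)"
    using \<open>D \<noteq> 0\<close> by (auto simp: power_mult_distrib sgn_real_def algebra_simps power2_eq_square split: if_splits)
  then have "\<bar>D\<bar> \<le> e * C" using e(1) by (simp add: zero_le_mult_iff)
  moreover have "e * C \<le> e * (\<bar>C\<bar> + 1)" using e(1) by (intro mult_left_mono) auto
  moreover have "0 < e * (\<bar>C\<bar> + 1)" using e(1) by (intro mult_pos_pos) auto
  ultimately show False by linarith
qed

lemma C_k_2D:
  assumes "C_k 2 u"
  shows "(u has_real_derivative deriv u x) (at x)"
    and "(deriv u has_real_derivative deriv (deriv u) x) (at x)"
    and "continuous_on UNIV (deriv u)"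
    and "continuous_on UNIV (deriv (deriv u))"
proof -
  have "(deriv ^^ j) u differentiable at x" if "j < 2" for j x
    using assms that unfolding C_k_def by blast
  from this[of 0] this[of 1] have 1: "u differentiable at x" "deriv u differentiable at x" for x
    by simp_all
  show "continuous_on UNIV (deriv (deriv u))"
    using assms unfolding C_k_def by (simp add: numeral_2_eq_2)
  show 2: "(u has_real_derivative deriv u x) (at x)"
    "(deriv u has_real_derivative deriv (deriv u) x) (at x)" for x
    using 1 by (auto simp: DERIV_deriv_iff_real_differentiable)
  show "continuous_on UNIV (deriv u)"
    using 2(2) by (intro continuous_at_imp_continuous_on) (auto intro: DERIV_isCont)
qed

text \<open>
  The integrability conditions are those under which the energy is the difference of two convergent
  integrals.
\<close>

locale log_gas_minimizer = prob_space \<nu> for \<nu> :: "real measure" +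
  fixes u :: "real \<Rightarrow> real"
  assumes sets_nu[measurable_cong]: "sets \<nu> = sets borel"
    and AE_off_diagonal: "AE (t, s) in \<nu> \<Otimes>\<^sub>M \<nu>. t \<noteq> s"
    and integrable_log: "integrable (\<nu> \<Otimes>\<^sub>M \<nu>) (\<lambda>(t, s). ln \<bar>t - s\<bar>)"
    and integrable_u: "integrable \<nu> u"
    and convex_u: "convex_on UNIV u"
    and C2_u: "C_k 2 u"
    and minimal: "borel_prob \<rho> \<Longrightarrow> free_energy u \<nu> \<le> free_energy u \<rho>"
begin

lemmas deriv_u = C_k_2D(1)[OF C2_u] and deriv2_u = C_k_2D(2)[OF C2_u]
  and cont_du = C_k_2D(3)[OF C2_u] and cont_ddu = C_k_2D(4)[OF C2_u]

lemma measurable_du[measurable]: "deriv u \<in> borel_measurable borel"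
  using cont_du by (rule borel_measurable_continuous_onI)

lemma measurable_u[measurable]: "u \<in> borel_measurable borel"
  using deriv_u by (intro borel_measurable_continuous_onI continuous_at_imp_continuous_on)
    (auto intro: DERIV_isCont)

lemma tangent: "u s + deriv u s * (x - s) \<le> u x"
  using convex_on_imp_above_tangent[OF convex_u, of s x "deriv u s"] deriv_u[of s] by simp

text \<open>
  Compare \<open>\<nu>\<close> with its image \<open>\<rho>\<close> under \<open>F = id + e g\<close>. For small \<open>e\<close> the factor
  \<open>1 + e J\<close> by which \<open>F\<close> stretches distances stays above \<open>1 / 2\<close>, so \<open>F\<close> is injective and
  \<open>ln (1 + e J)\<close> differs from \<open>e J\<close> by \<open>O(e\<^sup>2)\<close>; convexity of \<open>u\<close> and the Lipschitz bound for
  \<open>u'\<close> near the support of \<open>g\<close> control \<open>u \<circ> F\<close> to the same order. Both signs of \<open>e\<close> are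
  admissible, which turns the inequality into an equation.
\<close>

lemma first_variation:
  assumes lip: "L-lipschitz_on UNIV g" and bd: "\<And>s. \<bar>g s\<bar> \<le> G"
    and supp: "\<And>s. R < \<bar>s\<bar> \<Longrightarrow> g s = 0"
  shows "(\<integral>s. deriv u s * g s \<partial>\<nu>) = (\<integral>(t, s). (g t - g s) / (t - s) \<partial>(\<nu> \<Otimes>\<^sub>M \<nu>))"
proof -
  let ?P = "\<nu> \<Otimes>\<^sub>M \<nu>"
  interpret P: pair_prob_space \<nu> \<nu> ..
  define J where "J = (\<lambda>(t, s). (g t - g s) / (t - s))"
  have L0: "0 \<le> L" using lip by (rule lipschitz_on_nonneg)
  have G0: "0 \<le> G" using bd[of 0] by linarith
  have gm[measurable]: "g \<in> borel_measurable borel"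
    using lipschitz_on_continuous_on[OF lip] by (rule borel_measurable_continuous_onI)
  have Jm[measurable]: "J \<in> borel_measurable ?P" unfolding J_def by measurable
  have Jb: "\<bar>J z\<bar> \<le> L" for z
  proof -
    obtain t s where z: "z = (t, s)" by (cases z)
    have "\<bar>g t - g s\<bar> \<le> L * \<bar>t - s\<bar>" using lipschitz_onD[OF lip, of t s] by (simp add: dist_real_def)
    then show ?thesis using L0 by (cases "t = s") (auto simp: z J_def abs_divide field_simps)
  qed
  have intJ: "integrable ?P J"
    by (rule P.integrable_const_bound[where B = L]) (use Jb in auto)
  \<comment> \<open>The margin \<open>1\<close> contains the displacements \<open>e g\<close>, which are bounded by \<open>1 / 2\<close> below.\<close>
  let ?K = "{- (\<bar>R\<bar> + 1)..\<bar>R\<bar> + 1}"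
  have "bounded (deriv (deriv u) ` ?K)" "bounded (deriv u ` ?K)"
    by (auto intro!: compact_imp_bounded compact_continuous_image continuous_on_subset[OF cont_ddu]
        continuous_on_subset[OF cont_du])
  then obtain M B where "\<And>x. x \<in> ?K \<Longrightarrow> \<bar>deriv (deriv u) x\<bar> \<le> M"
    and duB: "\<And>x. x \<in> ?K \<Longrightarrow> \<bar>deriv u x\<bar> \<le> B" and "0 < M" and "0 < B"
    unfolding bounded_pos by fastforce
  then have du_lip: "\<bar>deriv u y - deriv u x\<bar> \<le> M * \<bar>y - x\<bar>" if "x \<in> ?K" "y \<in> ?K" for x y
    using field_differentiable_bound[of ?K "deriv u" "deriv (deriv u)" M y x] that deriv2_u
    by (auto intro: has_field_derivative_at_within)
  have dug: "\<bar>deriv u s * g s\<bar> \<le> B * G" for s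
  proof (cases "s \<in> ?K")
    case True
    then show ?thesis unfolding abs_mult using \<open>0 < B\<close> bd duB by (intro mult_mono) auto
  next
    case False
    then have "g s = 0" by (intro supp) auto
    then show ?thesis using \<open>0 < B\<close> G0 by simp
  qed
  have intdug: "integrable \<nu> (\<lambda>s. deriv u s * g s)"
    by (rule integrable_const_bound[where B = "B * G"]) (use dug in auto)
  define D where "D = (\<integral>s. deriv u s * g s \<partial>\<nu>) - (\<integral>z. J z \<partial>?P)"
  have "0 \<le> e * D + e\<^sup>2 * (M * G\<^sup>2 + 2 * L\<^sup>2)" if e: "\<bar>e\<bar> \<le> 1 / (2 * (L + G + 1))" for e
  proof -
    have e0: "\<bar>e\<bar> * (L + G + 1) \<le> 1 / 2" using e L0 G0 by (simp add: field_simps)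
    have eL: "\<bar>e\<bar> * L \<le> 1 / 2"
      using mult_left_mono[of L "L + G + 1" "\<bar>e\<bar>"] e0 G0 by linarith
    have eG: "\<bar>e\<bar> * G \<le> 1 / 2"
      using mult_left_mono[of G "L + G + 1" "\<bar>e\<bar>"] e0 L0 by linarith
    have eJ: "\<bar>e * J z\<bar> \<le> \<bar>e\<bar> * L" for z
      unfolding abs_mult using Jb by (intro mult_left_mono) auto
    have eg: "\<bar>e * g s\<bar> \<le> \<bar>e\<bar> * G" for s
      unfolding abs_mult using bd by (intro mult_left_mono) auto
    define F where "F = (\<lambda>s. s + e * g s)"
    have Fm[measurable]: "F \<in> borel_measurable borel" unfolding F_def by measurable
    define \<rho> where "\<rho> = distr \<nu> borel F"
    have rho: "borel_prob \<rho>" unfolding \<rho>_def borel_prob_def by (auto intro!: prob_space_distr)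
    interpret R: prob_space \<rho> using rho by (simp add: borel_prob_def)
    have PR: "\<rho> \<Otimes>\<^sub>M \<rho> = distr ?P (borel \<Otimes>\<^sub>M borel) (\<lambda>(t, s). (F t, F s))"
      unfolding \<rho>_def
      by (rule pair_measure_distr) (auto intro: R.sigma_finite_measure_axioms simp flip: \<rho>_def)
    have split: "F t - F s = (t - s) * (1 + e * J (t, s))" for t s
      by (cases "t = s") (auto simp: F_def J_def field_simps)
    have pos: "1 / 2 \<le> 1 + e * J z" for z using eJ[of z] eL by linarith
    have ne: "F t \<noteq> F s" if "t \<noteq> s" for t s
    proof -
      have "(t - s) * (1 + e * J (t, s)) \<noteq> 0" using that pos[of "(t, s)"] by auto
      then show ?thesis using split[of t s] by auto
    qed
    have lnsplit: "ln \<bar>F t - F s\<bar> = ln \<bar>t - s\<bar> + ln (1 + e * J (t, s))" if "t \<noteq> s" for t s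
      using that pos[of "(t, s)"] by (simp add: split abs_mult ln_mult_pos)
    have lnb: "\<bar>ln (1 + e * J z) - e * J z\<bar> \<le> 2 * (e * J z)\<^sup>2" for z
      using eJ[of z] eL by (intro abs_ln_one_plus_x_minus_x_bound) linarith
    have sqb: "(e * J z)\<^sup>2 \<le> e\<^sup>2 * L\<^sup>2" for z
      using power_mono[OF eJ[of z], of 2] by (simp add: power_mult_distrib)
    have intln1: "integrable ?P (\<lambda>z. ln (1 + e * J z))"
    proof (rule P.integrable_const_bound[where B = "\<bar>e\<bar> * L + 2 * (e\<^sup>2 * L\<^sup>2)"])
      have "\<bar>ln (1 + e * J z)\<bar> \<le> \<bar>e\<bar> * L + 2 * (e\<^sup>2 * L\<^sup>2)" for z
        using lnb[of z] sqb[of z] eJ[of z] by linarith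
      then show "AE z in ?P. norm (ln (1 + e * J z)) \<le> \<bar>e\<bar> * L + 2 * (e\<^sup>2 * L\<^sup>2)" by simp
    qed measurable
    have lnlow: "e * (\<integral>z. J z \<partial>?P) - 2 * (e\<^sup>2 * L\<^sup>2) \<le> (\<integral>z. ln (1 + e * J z) \<partial>?P)"
    proof -
      have "(\<integral>z. e * J z - 2 * (e\<^sup>2 * L\<^sup>2) \<partial>?P) \<le> (\<integral>z. ln (1 + e * J z) \<partial>?P)"
      proof (intro integral_mono)
        fix z
        show "e * J z - 2 * (e\<^sup>2 * L\<^sup>2) \<le> ln (1 + e * J z)"
          using lnb[of z] sqb[of z] by linarith
      qed (use intJ intln1 in auto)
      then show ?thesis using intJ by (simp add: P.prob_space)
    qed
    have uup: "u (F s) \<le> u s + e * (deriv u s * g s) + e\<^sup>2 * (M * G\<^sup>2)" for s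
    proof (cases "\<bar>s\<bar> \<le> R")
      case True
      have K: "s \<in> ?K" "F s \<in> ?K" using True eg[of s] eG by (auto simp: F_def)
      have "u (F s) \<le> u s + deriv u (F s) * (F s - s)" using tangent[of "F s" s] by (simp add: algebra_simps)
      also have "deriv u (F s) * (F s - s) = e * (deriv u s * g s) + (deriv u (F s) - deriv u s) * (e * g s)"
        by (simp add: F_def algebra_simps)
      also have "(deriv u (F s) - deriv u s) * (e * g s) \<le> (M * \<bar>e * g s\<bar>) * \<bar>e * g s\<bar>"
      proof (rule order_trans[OF abs_ge_self], unfold abs_mult, rule mult_right_mono)
        show "\<bar>deriv u (F s) - deriv u s\<bar> \<le> M * (\<bar>e\<bar> * \<bar>g s\<bar>)"
          using du_lip[OF K] by (simp add: F_def abs_mult)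
      qed simp
      also have "\<dots> = M * \<bar>e * g s\<bar>\<^sup>2" by (simp only: power2_eq_square mult.assoc)
      also have "\<dots> = M * (e\<^sup>2 * (g s)\<^sup>2)" by (simp only: power2_abs power_mult_distrib)
      also have "\<dots> \<le> M * (e\<^sup>2 * G\<^sup>2)"
        using \<open>0 < M\<close> power_mono[OF bd[of s], of 2] by (intro mult_left_mono) auto
      finally show ?thesis by (simp add: algebra_simps)
    next
      case False
      then have "g s = 0" by (intro supp) auto
      then show ?thesis using \<open>0 < M\<close> by (simp add: F_def)
    qed
    have ulow: "u s + e * (deriv u s * g s) \<le> u (F s)" for s
      using tangent[of s "F s"] by (simp add: F_def algebra_simps)
    have intuF: "integrable \<nu> (\<lambda>s. u (F s))"
    proof -
      have "integrable \<nu> (\<lambda>s. u (F s) - (u s + e * (deriv u s * g s)))"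
      proof (rule integrable_const_bound[where B = "e\<^sup>2 * (M * G\<^sup>2)"])
        have "\<bar>u (F s) - (u s + e * (deriv u s * g s))\<bar> \<le> e\<^sup>2 * (M * G\<^sup>2)" for s
          using uup[of s] ulow[of s] by linarith
        then show "AE s in \<nu>. norm (u (F s) - (u s + e * (deriv u s * g s))) \<le> e\<^sup>2 * (M * G\<^sup>2)" by simp
      qed measurable
      from Bochner_Integration.integrable_add[OF this, of "\<lambda>s. u s + e * (deriv u s * g s)"]
      show ?thesis using integrable_u intdug by simp
    qed
    have uint: "(\<integral>s. u (F s) \<partial>\<nu>) \<le> (\<integral>s. u s \<partial>\<nu>) + e * (\<integral>s. deriv u s * g s \<partial>\<nu>) + e\<^sup>2 * (M * G\<^sup>2)"
    proof -
      have "(\<integral>s. u (F s) \<partial>\<nu>) \<le> (\<integral>s. u s + e * (deriv u s * g s) + e\<^sup>2 * (M * G\<^sup>2) \<partial>\<nu>)"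
        by (intro integral_mono uup) (use intuF integrable_u intdug in auto)
      then show ?thesis using integrable_u intdug by (simp add: prob_space)
    qed
    have logF: "AE z in ?P. (case z of (t, s) \<Rightarrow> ln \<bar>F t - F s\<bar>)
        = (case z of (t, s) \<Rightarrow> ln \<bar>t - s\<bar>) + ln (1 + e * J z)"
      using AE_off_diagonal by eventually_elim (auto simp: lnsplit)
    have intlogF: "integrable ?P (\<lambda>(t, s). ln \<bar>F t - F s\<bar>)"
    proof (rule iffD2[OF integrable_cong_AE[OF _ _ logF]])
      show "integrable ?P (\<lambda>z. (case z of (t, s) \<Rightarrow> ln \<bar>t - s\<bar>) + ln (1 + e * J z))"
        by (rule Bochner_Integration.integrable_add[OF integrable_log intln1])
    qed measurable
    have "(\<integral>(t, s). ln \<bar>F t - F s\<bar> \<partial>?P)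
        = (\<integral>z. (case z of (t, s) \<Rightarrow> ln \<bar>t - s\<bar>) + ln (1 + e * J z) \<partial>?P)"
      by (rule integral_cong_AE[OF _ _ logF]) measurable
    also have "\<dots> = (\<integral>(t, s). ln \<bar>t - s\<bar> \<partial>?P) + (\<integral>z. ln (1 + e * J z) \<partial>?P)"
      by (rule Bochner_Integration.integral_add[OF integrable_log intln1])
    finally have logint: "(\<integral>(t, s). ln \<bar>F t - F s\<bar> \<partial>?P)
        = (\<integral>(t, s). ln \<bar>t - s\<bar> \<partial>?P) + (\<integral>z. ln (1 + e * J z) \<partial>?P)" .
    have "free_energy u \<rho> = ereal ((\<integral>s. u s \<partial>\<rho>) - (\<integral>(t, s). ln \<bar>t - s\<bar> \<partial>(\<rho> \<Otimes>\<^sub>M \<rho>)))"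
    proof (rule free_energy_eq_real)
      have "AE z in ?P. case (case z of (t, s) \<Rightarrow> (F t, F s)) of (t, s) \<Rightarrow> t \<noteq> s"
        using AE_off_diagonal by eventually_elim (auto simp: ne)
      then show "AE (t, s) in \<rho> \<Otimes>\<^sub>M \<rho>. t \<noteq> s"
        unfolding PR by (subst AE_distr_iff) (auto, measurable)
      show "integrable (\<rho> \<Otimes>\<^sub>M \<rho>) (\<lambda>(t, s). ln \<bar>t - s\<bar>)"
        unfolding PR using intlogF by (subst integrable_distr_eq) (auto simp: split_beta')
      show "integrable \<rho> u"
        unfolding \<rho>_def using intuF by (subst integrable_distr_eq) auto
    qed
    also have "(\<integral>s. u s \<partial>\<rho>) = (\<integral>s. u (F s) \<partial>\<nu>)"
      unfolding \<rho>_def by (subst integral_distr) auto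
    also have "(\<integral>(t, s). ln \<bar>t - s\<bar> \<partial>(\<rho> \<Otimes>\<^sub>M \<rho>)) = (\<integral>(t, s). ln \<bar>F t - F s\<bar> \<partial>?P)"
      unfolding PR by (subst integral_distr) (auto simp: split_beta')
    finally have "(\<integral>s. u s \<partial>\<nu>) - (\<integral>(t, s). ln \<bar>t - s\<bar> \<partial>?P)
        \<le> (\<integral>s. u (F s) \<partial>\<nu>) - (\<integral>(t, s). ln \<bar>F t - F s\<bar> \<partial>?P)"
      using minimal[OF rho] free_energy_eq_real[OF AE_off_diagonal integrable_log integrable_u] by simp
    then show ?thesis
      using uint lnlow logint by (simp add: D_def algebra_simps)
  qed
  then have "D = 0"
    by (intro zero_slope_of_quadratic_bound[of "1 / (2 * (L + G + 1))"]) (use L0 G0 in auto)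
  then show ?thesis by (simp add: D_def J_def)
qed

end

section \<open>The Schwinger-Dyson equation\<close>

text \<open>
  Equal to \<open>1\<close> for \<open>\<bar>t\<bar> \<le> n + 1\<close> and to \<open>0\<close> for \<open>\<bar>t\<bar> \<ge> 2 (n + 1)\<close>; the slope \<open>1 / (n + 1)\<close> in
  between tends to \<open>0\<close>, which makes the commutator with the difference quotient disappear in the
  limit.
\<close>

definition cutoff :: "nat \<Rightarrow> real \<Rightarrow> real" where
  "cutoff n t = max 0 (min 1 (2 - \<bar>t\<bar> / (real n + 1)))"

lemma cutoff_range: "0 \<le> cutoff n t" "cutoff n t \<le> 1"
  by (auto simp: cutoff_def)

lemma cutoff_eq_0: "2 * (real n + 1) < \<bar>t\<bar> \<Longrightarrow> cutoff n t = 0"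
proof -
  assume "2 * (real n + 1) < \<bar>t\<bar>"
  then have "2 \<le> \<bar>t\<bar> / (real n + 1)" by (simp add: le_divide_eq)
  then show ?thesis by (simp add: cutoff_def)
qed

lemma cutoff_mono: "n \<le> m \<Longrightarrow> cutoff n t \<le> cutoff m t"
proof -
  assume "n \<le> m"
  then have "\<bar>t\<bar> / (real m + 1) \<le> \<bar>t\<bar> / (real n + 1)" by (intro divide_left_mono) auto
  then show ?thesis unfolding cutoff_def by (intro max.mono min.mono) auto
qed

lemma cutoff_lipschitz: "\<bar>cutoff n t - cutoff n s\<bar> \<le> \<bar>t - s\<bar> / (real n + 1)"
proof -
  have "\<bar>\<bar>t\<bar> / (real n + 1) - \<bar>s\<bar> / (real n + 1)\<bar> \<le> \<bar>t - s\<bar> / (real n + 1)"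
    by (simp add: abs_divide divide_right_mono flip: diff_divide_distrib)
  moreover have "\<bar>max 0 (min 1 (2 - p)) - max 0 (min 1 (2 - q))\<bar> \<le> \<bar>p - q\<bar>" for p q :: real
    by (simp add: max_def min_def abs_minus_commute)
  ultimately show ?thesis unfolding cutoff_def by (rule order_trans[rotated])
qed

lemma cutoff_tendsto: "(\<lambda>n. cutoff n t) \<longlonglongrightarrow> 1"
proof (rule tendsto_eventually)
  obtain N where "\<bar>t\<bar> \<le> real N" using real_arch_simple by blast
  moreover have "cutoff n t = 1" if "\<bar>t\<bar> \<le> real N" "N \<le> n" for n
  proof -
    have "\<bar>t\<bar> / (real n + 1) \<le> 1" using that by (simp add: divide_le_eq)
    then show ?thesis by (simp add: cutoff_def)
  qed
  ultimately show "\<forall>\<^sub>F n in sequentially. cutoff n t = 1"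
    by (intro eventually_sequentiallyI[of N])
qed

lemma cutoff_mult_tendsto:
  "(\<lambda>n. case z of (t, s) \<Rightarrow> cutoff n t * q t s) \<longlonglongrightarrow> (case z of (t, s) \<Rightarrow> q t s)"
  using tendsto_mult[OF cutoff_tendsto[of "fst z"] tendsto_const[of "q (fst z) (snd z)"]]
  by (simp add: split_beta)

lemma measurable_cutoff[measurable]: "cutoff n \<in> borel_measurable borel"
  unfolding cutoff_def by measurable

text \<open>
  Truncations of \<open>C\<^sup>1\<close> functions are admissible directions for \<open>first_variation\<close>. Composing \<open>h\<close> with
  the projection \<open>c\<close> onto the support of the cutoff leaves the product unchanged and makes \<open>h\<close>
  globally bounded and Lipschitz.
\<close>

lemma cutoff_mult_lipschitz:
  assumes der: "\<And>x. (h has_real_derivative h' x) (at x)" and cont: "continuous_on UNIV h'"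
  obtains L G where "L-lipschitz_on UNIV (\<lambda>s. cutoff n s * h s)" "\<And>s. \<bar>cutoff n s * h s\<bar> \<le> G"
proof -
  let ?R = "2 * (real n + 1)" let ?K = "{-?R..?R}"
  define c where "c = (\<lambda>s. max (-?R) (min ?R s))"
  have cK: "c s \<in> ?K" for s by (auto simp: c_def)
  have c1: "\<bar>c t - c s\<bar> \<le> \<bar>t - s\<bar>" for t s by (auto simp: c_def)
  have eq: "cutoff n s * h s = cutoff n s * h (c s)" for s
    using cutoff_eq_0[of n s] by (cases "\<bar>s\<bar> \<le> ?R") (auto simp: c_def max_def min_def)
  have ch: "continuous_on UNIV h"
    using der by (intro continuous_at_imp_continuous_on) (auto intro: DERIV_isCont)
  have "bounded (h ` ?K)" "bounded (h' ` ?K)"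
    by (auto intro!: compact_imp_bounded compact_continuous_image continuous_on_subset[OF ch]
        continuous_on_subset[OF cont])
  then obtain B M where B: "\<And>x. x \<in> ?K \<Longrightarrow> \<bar>h x\<bar> \<le> B" "0 < B"
    and M: "\<And>x. x \<in> ?K \<Longrightarrow> \<bar>h' x\<bar> \<le> M" "0 < M"
    unfolding bounded_pos by fastforce
  have hl: "\<bar>h y - h x\<bar> \<le> M * \<bar>y - x\<bar>" if "x \<in> ?K" "y \<in> ?K" for x y
    using field_differentiable_bound[of ?K h h' M y x] that der M
    by (auto intro: has_field_derivative_at_within)
  have bd: "\<bar>cutoff n s * h s\<bar> \<le> B" for s
    unfolding eq abs_mult using cutoff_range[of n s] B(1)[OF cK, of s]
    by (metis abs_ge_zero abs_of_nonneg mult_left_le_one_le order_trans)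
  have "(M + B)-lipschitz_on UNIV (\<lambda>s. cutoff n s * h s)"
  proof (rule lipschitz_onI)
    fix t s
    have "\<bar>cutoff n t * (h (c t) - h (c s))\<bar> \<le> 1 * (M * \<bar>t - s\<bar>)"
      unfolding abs_mult
    proof (rule mult_mono)
      have "M * \<bar>c t - c s\<bar> \<le> M * \<bar>t - s\<bar>" using M(2) c1 by (intro mult_left_mono) auto
      with hl[OF cK cK, of t s] show "\<bar>h (c t) - h (c s)\<bar> \<le> M * \<bar>t - s\<bar>" by linarith
    qed (use cutoff_range[of n t] in auto)
    moreover have "\<bar>(cutoff n t - cutoff n s) * h (c s)\<bar> \<le> \<bar>t - s\<bar> * B"
      unfolding abs_mult
    proof (rule mult_mono)
      have "\<bar>t - s\<bar> / (real n + 1) \<le> \<bar>t - s\<bar>" by (simp add: divide_le_eq distrib_left)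
      with cutoff_lipschitz[of n t s] show "\<bar>cutoff n t - cutoff n s\<bar> \<le> \<bar>t - s\<bar>" by linarith
    qed (use B(1)[OF cK, of s] in auto)
    moreover have "cutoff n t * h (c t) - cutoff n s * h (c s)
        = cutoff n t * (h (c t) - h (c s)) + (cutoff n t - cutoff n s) * h (c s)"
      by (simp add: algebra_simps)
    moreover have "(M + B) * \<bar>t - s\<bar> = 1 * (M * \<bar>t - s\<bar>) + \<bar>t - s\<bar> * B"
      by (simp add: distrib_right mult.commute)
    ultimately show "dist (cutoff n t * h t) (cutoff n s * h s) \<le> (M + B) * dist t s"
      unfolding dist_real_def eq[of t] eq[of s] by linarith
  qed (use M B in auto)
  with bd that show thesis by blast
qed

context log_gas_minimizer
begin

text \<open>
  The difference quotient \<open>T\<close> of \<open>cutoff n * h\<close> splits by the Leibniz rule into the truncated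
  quotient \<open>Q n\<close> of \<open>h\<close> and an error \<open>E n\<close> carrying the quotient of the cutoff, and
  \<open>\<bar>E n\<bar> \<le> H / (n + 1)\<close>.
\<close>

lemma truncated_schwinger_dyson:
  assumes der: "\<And>x. (h has_real_derivative h' x) (at x)" and cont: "continuous_on UNIV h'"
    and U: "AE s in \<nu>. \<bar>deriv u s\<bar> \<le> U" and H: "AE s in \<nu>. \<bar>h s\<bar> \<le> H"
  shows "integrable (\<nu> \<Otimes>\<^sub>M \<nu>) (\<lambda>(t, s). cutoff n t * ((h t - h s) / (t - s)))"
    and "(\<lambda>n. \<integral>(t, s). cutoff n t * ((h t - h s) / (t - s)) \<partial>(\<nu> \<Otimes>\<^sub>M \<nu>))
      \<longlonglongrightarrow> (\<integral>s. deriv u s * h s \<partial>\<nu>)"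
proof -
  let ?P = "\<nu> \<Otimes>\<^sub>M \<nu>"
  interpret P: pair_prob_space \<nu> \<nu> ..
  have hm[measurable]: "h \<in> borel_measurable borel"
    using der by (intro borel_measurable_continuous_onI continuous_at_imp_continuous_on)
      (auto intro: DERIV_isCont)
  define E where "E n = (\<lambda>(t, s). h s * ((cutoff n t - cutoff n s) / (t - s)))" for n
  define Q where "Q n = (\<lambda>(t, s). cutoff n t * ((h t - h s) / (t - s)))" for n
  have Em[measurable]: "E n \<in> borel_measurable ?P" for n unfolding E_def by measurable
  have Qm[measurable]: "Q n \<in> borel_measurable ?P" for n unfolding Q_def by measurable
  have "\<bar>(cutoff n t - cutoff n s) / (t - s)\<bar> \<le> 1 / (real n + 1)" for n t s
    using cutoff_lipschitz[of n t s] by (cases "t = s") (auto simp: abs_divide field_simps)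
  then have Eb': "\<bar>E n (t, s)\<bar> \<le> H * (1 / (real n + 1))" if "\<bar>h s\<bar> \<le> H" for n t s
    unfolding E_def using that by (simp only: split_conv abs_mult) (rule mult_mono, auto)
  have Eb: "AE z in ?P. norm (E n z) \<le> H * (1 / (real n + 1))" for n
    using AE_pair_both[OF H] by eventually_elim (use Eb' in \<open>auto simp: split_paired_all\<close>)
  have intE: "integrable ?P (E n)" for n
    by (rule P.integrable_const_bound[OF Eb]) measurable
  have E0: "(\<lambda>n. \<integral>z. E n z \<partial>?P) \<longlonglongrightarrow> 0"
  proof (rule Lim_null_comparison)
    have "norm (\<integral>z. E n z \<partial>?P) \<le> H * (1 / (real n + 1))" for n
    proof -
      have "norm (\<integral>z. E n z \<partial>?P) \<le> (\<integral>z. norm (E n z) \<partial>?P)" by (rule integral_norm_bound)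
      also have "\<dots> \<le> (\<integral>z. H * (1 / (real n + 1)) \<partial>?P)"
        by (rule integral_mono_AE) (use intE Eb in auto)
      finally show ?thesis by (simp add: P.prob_space)
    qed
    then show "\<forall>\<^sub>F n in sequentially. norm (\<integral>z. E n z \<partial>?P) \<le> H * (1 / (real n + 1))" by simp
    show "(\<lambda>n. H * (1 / (real n + 1))) \<longlonglongrightarrow> 0" using LIMSEQ_Suc[OF lim_const_over_n[of H]] by (simp only: of_nat_Suc mult_1_right times_divide_eq_right add.commute[of 1])
  qed
  have sd: "(\<integral>s. deriv u s * (cutoff n s * h s) \<partial>\<nu>) - (\<integral>z. E n z \<partial>?P) = (\<integral>z. Q n z \<partial>?P)
      \<and> integrable ?P (Q n)" for n
  proof -
    obtain L G where L: "L-lipschitz_on UNIV (\<lambda>s. cutoff n s * h s)"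
      and G: "\<And>s. \<bar>cutoff n s * h s\<bar> \<le> G"
      using cutoff_mult_lipschitz[OF der cont] by blast
    define T where "T = (\<lambda>(t, s). (cutoff n t * h t - cutoff n s * h s) / (t - s))"
    have Tm[measurable]: "T \<in> borel_measurable ?P" unfolding T_def by measurable
    have L0: "0 \<le> L" using L by (rule lipschitz_on_nonneg)
    have "\<bar>T (t, s)\<bar> \<le> L" for t s
      using lipschitz_onD[OF L, of t s] L0
      by (cases "t = s") (auto simp: T_def dist_real_def abs_divide field_simps)
    then have intT: "integrable ?P T"
      by (intro P.integrable_const_bound[where B = L]) (auto simp: split_paired_all)
    have Q: "Q n = (\<lambda>z. T z - E n z)"
      by (auto simp: Q_def T_def E_def fun_eq_iff algebra_simps add_divide_distrib diff_divide_distrib)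
    have "(\<integral>s. deriv u s * (cutoff n s * h s) \<partial>\<nu>) = (\<integral>z. T z \<partial>?P)"
      unfolding T_def
      by (rule first_variation[OF L G, of "2 * (real n + 1)"]) (simp add: cutoff_eq_0)
    then show ?thesis using intT intE by (simp add: Q)
  qed
  then show "integrable ?P (\<lambda>(t, s). cutoff n t * ((h t - h s) / (t - s)))"
    unfolding Q_def by blast
  have "(\<lambda>n. \<integral>s. deriv u s * (cutoff n s * h s) \<partial>\<nu>) \<longlonglongrightarrow> (\<integral>s. deriv u s * h s \<partial>\<nu>)"
  proof (rule integral_dominated_convergence[where w = "\<lambda>_. U * H"])
    show "AE s in \<nu>. (\<lambda>n. deriv u s * (cutoff n s * h s)) \<longlonglongrightarrow> deriv u s * h s"
      by (intro AE_I2) (use tendsto_mult[OF tendsto_const tendsto_mult[OF cutoff_tendsto tendsto_const]] in simp)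
    show "AE s in \<nu>. norm (deriv u s * (cutoff n s * h s)) \<le> U * H" for n
      using U H
    proof eventually_elim
      fix s assume "\<bar>deriv u s\<bar> \<le> U" "\<bar>h s\<bar> \<le> H"
      moreover have "\<bar>cutoff n s * h s\<bar> \<le> \<bar>h s\<bar>"
        using cutoff_range[of n s] by (simp add: abs_mult mult_left_le_one_le)
      ultimately show "norm (deriv u s * (cutoff n s * h s)) \<le> U * H"
        unfolding real_norm_def abs_mult[of "deriv u s"] by (intro mult_mono) auto
    qed
  qed auto
  from tendsto_diff[OF this E0] show "(\<lambda>n. \<integral>(t, s). cutoff n t * ((h t - h s) / (t - s)) \<partial>?P)
      \<longlonglongrightarrow> (\<integral>s. deriv u s * h s \<partial>\<nu>)"
    using sd unfolding Q_def by simp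
qed

lemma du_quotient_nonneg: "0 \<le> (deriv u t - deriv u s) / (t - s)"
proof -
  have "0 \<le> (deriv u t - deriv u s) * (t - s)"
    using tangent[of s t] tangent[of t s] by (simp add: algebra_simps)
  then show ?thesis by (simp add: zero_le_divide_iff zero_le_mult_iff)
qed

text \<open>
  The integrals of the truncated quotients increase with \<open>n\<close> and converge to \<open>\<integral> u'\<^sup>2 d\<nu>\<close>, so
  monotone convergence applies.
\<close>

lemma integrable_du_quotient:
  assumes U: "AE s in \<nu>. \<bar>deriv u s\<bar> \<le> U"
  shows "integrable (\<nu> \<Otimes>\<^sub>M \<nu>) (\<lambda>(t, s). (deriv u t - deriv u s) / (t - s))"
proof (rule integrable_monotone_convergence)
  note T = truncated_schwinger_dyson[OF deriv2_u cont_ddu U U]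
  show "integrable (\<nu> \<Otimes>\<^sub>M \<nu>) (\<lambda>(t, s). cutoff n t * ((deriv u t - deriv u s) / (t - s)))" for n
    by (rule T(1))
  show "(\<lambda>n. \<integral>(t, s). cutoff n t * ((deriv u t - deriv u s) / (t - s)) \<partial>(\<nu> \<Otimes>\<^sub>M \<nu>))
      \<longlonglongrightarrow> (\<integral>s. deriv u s * deriv u s \<partial>\<nu>)"
    by (rule T(2))
  show "AE z in \<nu> \<Otimes>\<^sub>M \<nu>. mono (\<lambda>n. case z of (t, s) \<Rightarrow> cutoff n t * ((deriv u t - deriv u s) / (t - s)))"
    by (intro AE_I2 monoI, unfold split_beta) (intro mult_right_mono cutoff_mono du_quotient_nonneg)
  show "AE z in \<nu> \<Otimes>\<^sub>M \<nu>. (\<lambda>n. case z of (t, s) \<Rightarrow> cutoff n t * ((deriv u t - deriv u s) / (t - s)))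
      \<longlonglongrightarrow> (case z of (t, s) \<Rightarrow> (deriv u t - deriv u s) / (t - s))"
    by (intro AE_I2 cutoff_mult_tendsto)
qed measurable

text \<open>
  The bound on \<open>u'\<close> makes \<open>f\<close> Lipschitz on the values that matter, so a multiple of the quotient of
  \<open>u'\<close> is an integrable majorant for the truncated quotients of \<open>f \<circ> u'\<close>.
\<close>

theorem schwinger_dyson:
  assumes der: "\<And>x. (f has_real_derivative f' x) (at x)" and cont: "continuous_on UNIV f'"
    and U: "AE s in \<nu>. \<bar>deriv u s\<bar> \<le> U"
  shows "integrable (\<nu> \<Otimes>\<^sub>M \<nu>) (\<lambda>(t, s). (f (deriv u t) - f (deriv u s)) / (t - s))"
    and "(\<integral>s. deriv u s * f (deriv u s) \<partial>\<nu>)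
      = (\<integral>(t, s). (f (deriv u t) - f (deriv u s)) / (t - s) \<partial>(\<nu> \<Otimes>\<^sub>M \<nu>))"
proof -
  let ?P = "\<nu> \<Otimes>\<^sub>M \<nu>" let ?K = "{-U..U}"
  let ?h = "\<lambda>s. f (deriv u s)"
  have cf: "continuous_on UNIV f"
    using der by (intro continuous_at_imp_continuous_on) (auto intro: DERIV_isCont)
  have fm[measurable]: "f \<in> borel_measurable borel" using cf by (rule borel_measurable_continuous_onI)
  have "bounded (f ` ?K)" "bounded (f' ` ?K)"
    by (auto intro!: compact_imp_bounded compact_continuous_image continuous_on_subset[OF cf]
        continuous_on_subset[OF cont])
  then obtain H M where H: "\<And>x. x \<in> ?K \<Longrightarrow> \<bar>f x\<bar> \<le> H"
    and M: "\<And>x. x \<in> ?K \<Longrightarrow> \<bar>f' x\<bar> \<le> M" "0 < M"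
    unfolding bounded_pos by fastforce
  have fl: "\<bar>f y - f x\<bar> \<le> M * \<bar>y - x\<bar>" if "x \<in> ?K" "y \<in> ?K" for x y
    using field_differentiable_bound[of ?K f f' M y x] that der M
    by (auto intro: has_field_derivative_at_within)
  have hder: "(?h has_real_derivative f' (deriv u x) * deriv (deriv u) x) (at x)" for x
    by (rule DERIV_chain2[OF der deriv2_u])
  have hcont: "continuous_on UNIV (\<lambda>x. f' (deriv u x) * deriv (deriv u) x)"
    by (intro continuous_on_mult cont_ddu continuous_on_compose2[OF cont cont_du]) auto
  have hH: "AE s in \<nu>. \<bar>?h s\<bar> \<le> H" using U by eventually_elim (rule H, auto)
  note T = truncated_schwinger_dyson[OF hder hcont U hH]
  have lim: "AE z in ?P. (\<lambda>n. case z of (t, s) \<Rightarrow> cutoff n t * ((?h t - ?h s) / (t - s)))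
      \<longlonglongrightarrow> (case z of (t, s) \<Rightarrow> (?h t - ?h s) / (t - s))"
    by (intro AE_I2 cutoff_mult_tendsto)
  have dom: "AE z in ?P. norm (case z of (t, s) \<Rightarrow> cutoff n t * ((?h t - ?h s) / (t - s)))
      \<le> M * (case z of (t, s) \<Rightarrow> (deriv u t - deriv u s) / (t - s))" for n
    using AE_pair_both[OF U]
  proof eventually_elim
    fix z assume z: "\<bar>deriv u (fst z)\<bar> \<le> U \<and> \<bar>deriv u (snd z)\<bar> \<le> U"
    obtain t s where ts: "z = (t, s)" by (cases z)
    have "\<bar>cutoff n t * ((?h t - ?h s) / (t - s))\<bar> \<le> 1 * (\<bar>?h t - ?h s\<bar> / \<bar>t - s\<bar>)"
      unfolding abs_mult abs_divide
      by (rule mult_right_mono) (use cutoff_range[of n t] in auto)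
    also have "\<dots> \<le> (M * \<bar>deriv u t - deriv u s\<bar>) / \<bar>t - s\<bar>"
      unfolding mult_1 using z by (intro divide_right_mono fl) (auto simp: ts)
    also have "\<dots> = M * \<bar>(deriv u t - deriv u s) / (t - s)\<bar>"
      by (simp add: abs_divide)
    also have "\<dots> = M * ((deriv u t - deriv u s) / (t - s))"
      by (simp only: abs_of_nonneg[OF du_quotient_nonneg])
    finally show "norm (case z of (t, s) \<Rightarrow> cutoff n t * ((?h t - ?h s) / (t - s)))
      \<le> M * (case z of (t, s) \<Rightarrow> (deriv u t - deriv u s) / (t - s))"
      unfolding ts split_conv real_norm_def .
  qed
  have w: "integrable ?P (\<lambda>z. M * (case z of (t, s) \<Rightarrow> (deriv u t - deriv u s) / (t - s)))"
    using integrable_du_quotient[OF U] by simp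
  show "integrable ?P (\<lambda>(t, s). (?h t - ?h s) / (t - s))"
    by (rule integrable_dominated_convergence[OF _ _ w lim dom]) measurable
  have "(\<lambda>n. \<integral>(t, s). cutoff n t * ((?h t - ?h s) / (t - s)) \<partial>?P)
      \<longlonglongrightarrow> (\<integral>(t, s). (?h t - ?h s) / (t - s) \<partial>?P)"
    by (rule integral_dominated_convergence[OF _ _ w lim dom]) measurable
  from LIMSEQ_unique[OF T(2) this]
  show "(\<integral>s. deriv u s * ?h s \<partial>\<nu>) = (\<integral>(t, s). (?h t - ?h s) / (t - s) \<partial>?P)" .
qed

end

section \<open>Legendre transform of a strictly convex function\<close>

locale C1_strictly_convex =
  fixes u :: "real \<Rightarrow> real"
  assumes strict: "strictly_convex u"
    and has_deriv: "(u has_real_derivative deriv u x) (at x)"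
    and cont_deriv: "continuous_on UNIV (deriv u)"
begin

lemma convex: "convex_on UNIV u"
proof (rule convex_onI)
  fix t x y :: real
  assume "0 < t" and "t < 1"
  show "u ((1 - t) *\<^sub>R x + t *\<^sub>R y) \<le> (1 - t) * u x + t * u y"
  proof (cases "x = y")
    case True
    then show ?thesis by (simp add: algebra_simps)
  next
    case False
    then show ?thesis
      using strict[unfolded strictly_convex_def, rule_format, of x y t] \<open>0 < t\<close> \<open>t < 1\<close> by simp
  qed
qed auto

lemma above_tangent: "u s + deriv u s * (x - s) \<le> u x"
  using convex_on_imp_above_tangent[OF convex, of s x "deriv u s"] has_deriv[of s] by simp

text \<open>
  The midpoint lies above the tangents at both ends but strictly below the chord.
\<close>

lemma strict_mono_deriv: "strict_mono (deriv u)"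
proof (rule strict_monoI)
  fix x y :: real
  assume "x < y"
  let ?m = "(x + y) / 2"
  have m: "(1 - 1 / 2) * x + 1 / 2 * y = ?m" by (simp add: field_simps)
  have "u ((1 - 1 / 2) * x + 1 / 2 * y) < (1 - 1 / 2) * u x + 1 / 2 * u y"
    by (rule strict[unfolded strictly_convex_def, rule_format]) (use \<open>x < y\<close> in auto)
  then have "2 * u ?m < u x + u y" unfolding m by simp
  moreover have "u x + deriv u x * ((y - x) / 2) \<le> u ?m" "u y - deriv u y * ((y - x) / 2) \<le> u ?m"
    using above_tangent[of x ?m] above_tangent[of y ?m] by (simp_all add: field_simps)
  ultimately have "deriv u x * ((y - x) / 2) < deriv u y * ((y - x) / 2)" by linarith
  then show "deriv u x < deriv u y" using \<open>x < y\<close> by simp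
qed

lemma inj_deriv: "inj (deriv u)"
  using strict_mono_deriv by (rule strict_mono_imp_inj_on)

lemma inv_deriv[simp]: "inv (deriv u) (deriv u t) = t"
  using inj_deriv by (rule inv_f_f)

text \<open>
  The range of \<open>u'\<close> is an interval without endpoints; this explicit neighbourhood is what the
  derivatives of the inverse and of the Legendre transform need.
\<close>

lemma nhd_in_range:
  shows "{deriv u (t - 1)<..<deriv u (t + 1)} \<subseteq> range (deriv u)"
    and "deriv u t \<in> {deriv u (t - 1)<..<deriv u (t + 1)}"
proof -
  have "{deriv u (t - 1)..deriv u (t + 1)} \<subseteq> range (deriv u)"
    by (rule connected_contains_Icc) (auto intro!: connected_continuous_image cont_deriv)
  then show "{deriv u (t - 1)<..<deriv u (t + 1)} \<subseteq> range (deriv u)" by force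
  show "deriv u t \<in> {deriv u (t - 1)<..<deriv u (t + 1)}"
    using strict_mono_deriv by (simp add: strict_mono_less)
qed

lemma open_range: "open (range (deriv u))"
proof (subst open_subopen, intro ballI)
  fix x assume "x \<in> range (deriv u)"
  then obtain t where "x = deriv u t" by blast
  then show "\<exists>T. open T \<and> x \<in> T \<and> T \<subseteq> range (deriv u)"
    using nhd_in_range[of t] open_greaterThanLessThan by blast
qed

lemma isCont_inv_deriv: "isCont (inv (deriv u)) (deriv u t)"
  by (rule isCont_inverse_function[of 1])
    (use cont_deriv in \<open>auto simp: continuous_on_eq_continuous_at\<close>)

lemma legendre_deriv_u: "legendre u (deriv u t) = ereal (deriv u t * t - u t)"
  unfolding legendre_def
proof (rule antisym)
  show "(SUP x. ereal (x * deriv u t - u x)) \<le> ereal (deriv u t * t - u t)"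
    using above_tangent[of t] by (intro SUP_least) (auto simp: algebra_simps)
  show "ereal (deriv u t * t - u t) \<le> (SUP x. ereal (x * deriv u t - u x))"
    by (rule SUP_upper2[of t]) (auto simp: mult.commute)
qed

text \<open>
  With \<open>y = u' s\<close>, the two tangent inequalities between \<open>s\<close> and \<open>t\<close> say that the increment of
  \<open>u\<^sup>*\<close> from \<open>u' t\<close> to \<open>y\<close> lies between \<open>t (y - u' t)\<close> and \<open>s (y - u' t)\<close>, and \<open>s\<close> tends to
  \<open>t\<close> by continuity of \<open>(u')\<^sup>-\<^sup>1\<close>. The squeeze covers the points where \<open>u''\<close>
  vanishes, at which \<open>(u')\<^sup>-\<^sup>1\<close> is not differentiable.
\<close>

lemma legendre_has_derivative:
  "((\<lambda>y. real_of_ereal (legendre u y)) has_real_derivative t) (at (deriv u t))"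
proof -
  let ?G = "\<lambda>y. real_of_ereal (legendre u y)" and ?w = "inv (deriv u)" and ?x = "deriv u t"
  let ?I = "{deriv u (t - 1)<..<deriv u (t + 1)}"
  have bound: "norm ((?G y - ?G ?x) / (y - ?x) - t) \<le> \<bar>?w y - t\<bar>" if y: "y \<in> ?I" "y \<noteq> ?x" for y
  proof -
    obtain s where s: "y = deriv u s" using nhd_in_range(1)[of t] y(1) by blast
    have "t * (y - ?x) \<le> ?G y - ?G ?x" "?G y - ?G ?x \<le> s * (y - ?x)"
      using above_tangent[of s t] above_tangent[of t s]
      by (simp_all add: s legendre_deriv_u algebra_simps)
    then have "\<bar>(?G y - ?G ?x) - t * (y - ?x)\<bar> \<le> \<bar>(s - t) * (y - ?x)\<bar>"
      by (simp add: left_diff_distrib)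
    then have "\<bar>(?G y - ?G ?x) - t * (y - ?x)\<bar> / \<bar>y - ?x\<bar> \<le> \<bar>s - t\<bar>"
      using y(2) by (simp add: abs_mult divide_le_eq)
    also have "\<bar>(?G y - ?G ?x) - t * (y - ?x)\<bar> / \<bar>y - ?x\<bar> = \<bar>(?G y - ?G ?x) / (y - ?x) - t\<bar>"
      using y(2) by (simp add: diff_divide_distrib flip: abs_divide)
    finally show ?thesis by (simp add: s)
  qed
  have "((\<lambda>y. (?G y - ?G ?x) / (y - ?x) - t) \<longlongrightarrow> 0) (at ?x)"
  proof (rule Lim_null_comparison)
    show "\<forall>\<^sub>F y in at ?x. norm ((?G y - ?G ?x) / (y - ?x) - t) \<le> \<bar>?w y - t\<bar>"
      unfolding eventually_at_topological
      by (rule exI[of _ ?I]) (use bound nhd_in_range(2)[of t] in auto)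
    have "((\<lambda>y. ?w y - t) \<longlongrightarrow> ?w ?x - t) (at ?x)"
      using isCont_inv_deriv[of t] by (intro tendsto_diff tendsto_const) (simp add: isCont_def)
    then show "((\<lambda>y. \<bar>?w y - t\<bar>) \<longlongrightarrow> 0) (at ?x)"
      by (intro tendsto_rabs_zero) simp
  qed
  then show ?thesis by (simp add: has_field_derivative_iff LIM_zero_iff)
qed

lemma legendre_deriv_eq: "legendre_deriv u (deriv u t) = t"
  unfolding legendre_deriv_def by (rule DERIV_imp_deriv) (rule legendre_has_derivative)

lemma deriv_legendre_deriv:
  assumes "(deriv u has_real_derivative D) (at t)" "D \<noteq> 0"
  shows "deriv (legendre_deriv u) (deriv u t) = inverse D"
proof (rule DERIV_imp_deriv)
  let ?I = "{deriv u (t - 1)<..<deriv u (t + 1)}"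
  have "(inv (deriv u) has_real_derivative inverse D) (at (deriv u t))"
  proof (rule DERIV_inverse_function)
    show "(deriv u has_real_derivative D) (at (inv (deriv u) (deriv u t)))" using assms by simp
    show "deriv u (t - 1) < deriv u t" "deriv u t < deriv u (t + 1)"
      using nhd_in_range(2)[of t] by auto
    show "deriv u (inv (deriv u) y) = y" if "deriv u (t - 1) < y" "y < deriv u (t + 1)" for y
      using nhd_in_range(1)[of t] that by (intro f_inv_into_f) auto
  qed (use assms isCont_inv_deriv in auto)
  then show "(legendre_deriv u has_real_derivative inverse D) (at (deriv u t))"
  proof (rule has_field_derivative_transform_within_open)
    show "inv (deriv u) y = legendre_deriv u y" if "y \<in> ?I" for y
      using nhd_in_range(1)[of t] that legendre_deriv_eq by force
  qed (use nhd_in_range(2)[of t] in auto)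
qed

end

section \<open>The Stein kernel of the pushforward\<close>

text \<open>
  Here \<open>f\<close> may fail to be measurable for \<open>M\<close>: kernels built from \<open>deriv\<close> and \<open>inv\<close> are only known
  to agree with a Borel function almost everywhere.
\<close>

lemma completion_cong_AE:
  fixes f g :: "'a \<Rightarrow> real"
  assumes g: "integrable M g" and eq: "AE x in M. f x = g x"
  shows "integrable (completion M) f" and "(\<integral>x. f x \<partial>completion M) = (\<integral>x. g x \<partial>M)"
proof -
  have gm: "g \<in> borel_measurable M" using g by auto
  then have gc: "g \<in> borel_measurable (completion M)" by (rule measurable_completion)
  have eqc: "AE x in completion M. f x = g x" using eq by (rule AE_completion)
  have fc: "f \<in> borel_measurable (completion M)"
  proof (rule measurableI)
    fix S :: "real set" assume "S \<in> sets borel"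
    then have gS: "g -` S \<inter> space (completion M) \<in> sets (completion M)"
      by (rule measurable_sets[OF gc])
    have ae: "AE x in completion M. x \<in> g -` S \<inter> space (completion M) \<longleftrightarrow> x \<in> f -` S \<inter> space (completion M)"
      using eqc by eventually_elim auto
    show "f -` S \<inter> space (completion M) \<in> sets (completion M)"
      by (rule completion.in_sets_AE[OF ae gS]) blast
  qed simp
  have "integrable (completion M) g" using g gm by (simp add: integrable_completion)
  then show "integrable (completion M) f"
    using integrable_cong_AE[OF fc gc eqc] by simp
  show "(\<integral>x. f x \<partial>completion M) = (\<integral>x. g x \<partial>M)"
    using integral_cong_AE[OF fc gc eqc] integral_completion[OF gm] by simp
qed

lemma deriv_half_square: "deriv (\<lambda>x::real. x\<^sup>2 / 2) = (\<lambda>x. x)"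
  by (rule ext, rule DERIV_imp_deriv) (auto intro!: derivative_eq_intros)

context log_gas_minimizer
begin

text \<open>
  The diagonal is null for \<open>\<nu> \<otimes> \<nu>\<close>, hence by injectivity of \<open>u'\<close> also for \<open>\<mu> \<otimes> \<mu>\<close>, so only the
  values of \<open>A\<close> at distinct points of the range of \<open>u'\<close> matter. On these, \<open>A\<close> times the difference
  quotient of \<open>f\<close> agrees with the Borel function \<open>B\<close>, whose pullback is the quotient in the
  Schwinger-Dyson equation.
\<close>

lemma stein_kernel_pushforward:
  assumes strict: "strictly_convex u"
    and U: "AE s in \<nu>. \<bar>deriv u s\<bar> \<le> U"
    and A: "\<And>t s. t \<noteq> s \<Longrightarrow> A (deriv u t) (deriv u s) = (deriv u t - deriv u s) / (t - s)"
  shows "is_free_stein_kernel (distr \<nu> borel (deriv u)) (\<lambda>x. x\<^sup>2 / 2) A"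
proof -
  interpret C: C1_strictly_convex u
    by unfold_locales (use strict deriv_u cont_du in auto)
  let ?P = "\<nu> \<Otimes>\<^sub>M \<nu>"
  define \<mu> where "\<mu> = distr \<nu> borel (deriv u)"
  interpret M: prob_space \<mu> unfolding \<mu>_def by (rule prob_space_distr) simp
  have PM: "\<mu> \<Otimes>\<^sub>M \<mu> = distr ?P (borel \<Otimes>\<^sub>M borel) (\<lambda>(t, s). (deriv u t, deriv u s))"
    unfolding \<mu>_def
    by (rule pair_measure_distr) (auto intro: M.sigma_finite_measure_axioms simp flip: \<mu>_def)
  \<comment> \<open>Outside the range \<open>inv\<close> is unspecified; extending by \<open>0\<close> gives a Borel inverse.\<close>
  define w where "w x = indicator (range (deriv u)) x *\<^sub>R inv (deriv u) x" for x
  have "continuous_on (range (deriv u)) (inv (deriv u))"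
    using C.isCont_inv_deriv by (intro continuous_at_imp_continuous_on) auto
  then have wm[measurable]: "w \<in> borel_measurable borel"
    unfolding w_def using C.open_range by (intro borel_measurable_continuous_on_indicator) auto
  have w: "w (deriv u t) = t" for t by (simp add: w_def)
  have "integrable \<mu> (\<lambda>x. deriv (\<lambda>x. x\<^sup>2 / 2) x * f x) \<and>
        integrable (completion (\<mu> \<Otimes>\<^sub>M \<mu>)) (\<lambda>(x, y). A x y * free_diff_quot f x y) \<and>
        (\<integral>x. deriv (\<lambda>x. x\<^sup>2 / 2) x * f x \<partial>\<mu>) =
          (\<integral>(x, y). A x y * free_diff_quot f x y \<partial>completion (\<mu> \<Otimes>\<^sub>M \<mu>))"
    if "smooth_fun f" for f
  proof -
    have ck: "C_k 1 f" using that by (simp add: smooth_fun_def)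
    then have fd: "(f has_real_derivative deriv f x) (at x)" for x
      unfolding C_k_def by (auto simp: DERIV_deriv_iff_real_differentiable)
    have fc: "continuous_on UNIV (deriv f)" using ck by (simp add: C_k_def)
    have cf: "continuous_on UNIV f"
      using fd by (intro continuous_at_imp_continuous_on) (auto intro: DERIV_isCont)
    have fm[measurable]: "f \<in> borel_measurable borel" using cf by (rule borel_measurable_continuous_onI)
    note SD = schwinger_dyson[OF fd fc U]
    define B where "B = (\<lambda>(x, y). (x - y) / (w x - w y) * ((f x - f y) / (x - y)))"
    have Bm[measurable]: "B \<in> borel_measurable (borel \<Otimes>\<^sub>M borel)" unfolding B_def by measurable
    have Bu: "B (deriv u t, deriv u s) = (f (deriv u t) - f (deriv u s)) / (t - s)" for t s
      using injD[OF C.inj_deriv, of t s] by (cases "t = s") (auto simp: B_def w)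
    have intB: "integrable (\<mu> \<Otimes>\<^sub>M \<mu>) B"
      unfolding PM using SD(1) by (subst integrable_distr_eq) (auto simp: split_beta' Bu)
    have intB_eq: "(\<integral>z. B z \<partial>(\<mu> \<Otimes>\<^sub>M \<mu>)) = (\<integral>s. deriv u s * f (deriv u s) \<partial>\<nu>)"
      unfolding PM SD(2) by (subst integral_distr) (auto simp: split_beta' Bu)
    have AB: "AE z in \<mu> \<Otimes>\<^sub>M \<mu>. (case z of (x, y) \<Rightarrow> A x y * free_diff_quot f x y) = B z"
    proof -
      let ?r = "range (deriv u)"
      have [measurable]: "?r \<in> sets borel" using C.open_range by auto
      have "AE z in ?P. case (case z of (t, s) \<Rightarrow> (deriv u t, deriv u s)) of
          (x, y) \<Rightarrow> x \<noteq> y \<and> x \<in> ?r \<and> y \<in> ?r"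
        using AE_off_diagonal by eventually_elim (auto dest: injD[OF C.inj_deriv])
      then have "AE (x, y) in \<mu> \<Otimes>\<^sub>M \<mu>. x \<noteq> y \<and> x \<in> ?r \<and> y \<in> ?r"
        unfolding PM by (subst AE_distr_iff) (auto, measurable)
      then show ?thesis
      proof eventually_elim
        fix z assume "case z of (x, y) \<Rightarrow> x \<noteq> y \<and> x \<in> ?r \<and> y \<in> ?r"
        then obtain t s where z: "z = (deriv u t, deriv u s)" "deriv u t \<noteq> deriv u s" by (cases z) auto
        then have "t \<noteq> s" by auto
        from A[OF this] z show "(case z of (x, y) \<Rightarrow> A x y * free_diff_quot f x y) = B z"
          by (auto simp: B_def w free_diff_quot_def)
      qed
    qed
    have "bounded (f ` {-U..U})"
      by (auto intro!: compact_imp_bounded compact_continuous_image continuous_on_subset[OF cf])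
    then obtain H where H: "\<And>x. x \<in> {-U..U} \<Longrightarrow> \<bar>f x\<bar> \<le> H"
      unfolding bounded_pos by fastforce
    have "integrable \<nu> (\<lambda>s. deriv u s * f (deriv u s))"
    proof (rule integrable_const_bound[where B = "U * H"])
      show "AE s in \<nu>. norm (deriv u s * f (deriv u s)) \<le> U * H"
        using U
      proof eventually_elim
        fix s assume "\<bar>deriv u s\<bar> \<le> U"
        moreover from this have "\<bar>f (deriv u s)\<bar> \<le> H" by (intro H) auto
        ultimately show "norm (deriv u s * f (deriv u s)) \<le> U * H"
          unfolding real_norm_def abs_mult by (intro mult_mono) auto
      qed
    qed measurable
    then have "integrable \<mu> (\<lambda>x. x * f x)"
      unfolding \<mu>_def by (subst integrable_distr_eq) auto
    moreover have "(\<integral>x. x * f x \<partial>\<mu>) = (\<integral>s. deriv u s * f (deriv u s) \<partial>\<nu>)"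
      unfolding \<mu>_def by (subst integral_distr) auto
    ultimately show ?thesis
      using completion_cong_AE[OF intB AB] intB_eq by (simp add: deriv_half_square)
  qed
  moreover have "C_k 1 (\<lambda>x. x\<^sup>2 / 2)"
    by (auto simp: C_k_def deriv_half_square)
  ultimately show ?thesis unfolding is_free_stein_kernel_def \<mu>_def by blast
qed

end

section \<open>The free Gibbs measure of a moment map\<close>

text \<open>
  If \<open>u'\<close> had a constant sign, the centered measure \<open>\<mu>\<close> would be concentrated at \<open>0\<close>, which
  absolute continuity excludes. Hence there is an increasing and a decreasing tangent line, and \<open>u\<close>
  lies above both.
\<close>

lemma moment_map_linear_growth:
  assumes mu: "borel_prob \<mu>" "(\<integral>x. x \<partial>\<mu>) = 0" "absolutely_continuous lborel \<mu>"
    and bd: "AE x in \<mu>. x \<in> {a..b}" and rng: "AE x in \<mu>. x \<in> range (deriv u)"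
    and tangent: "\<And>s x. u s + deriv u s * (x - s) \<le> u x"
  obtains c d where "0 < c" "\<And>s. c * \<bar>s\<bar> - d \<le> u s"
proof -
  interpret prob_space \<mu> using mu by (simp add: borel_prob_def)
  have sets[measurable_cong]: "sets \<mu> = sets borel" using mu by (simp add: borel_prob_def)
  have int: "integrable \<mu> (\<lambda>x. x)"
  proof (rule integrable_const_bound[where B = "\<bar>a\<bar> + \<bar>b\<bar>"])
    show "AE x in \<mu>. norm x \<le> \<bar>a\<bar> + \<bar>b\<bar>" using bd by eventually_elim auto
  qed measurable
  have "AE x in \<mu>. x \<noteq> 0"
    by (rule absolutely_continuous_AE[OF _ mu(3)]) (simp_all add: sets AE_lborel_singleton)
  then have no0: "\<not> (AE x in \<mu>. x = 0)"
  proof (intro notI)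
    assume "AE x in \<mu>. x \<noteq> 0" "AE x in \<mu>. x = 0"
    then have "AE x in \<mu>. False" by eventually_elim simp
    then show False by simp
  qed
  have "\<exists>t. 0 < deriv u t"
  proof (rule ccontr)
    assume "\<not> (\<exists>t. 0 < deriv u t)"
    then have "deriv u t \<le> 0" for t by (simp add: not_less)
    with rng have "AE x in \<mu>. 0 \<le> - x" by (auto elim!: eventually_mono)
    then show False using integral_nonneg_eq_0_iff_AE[of \<mu> "\<lambda>x. - x"] int mu(2) no0 by simp
  qed
  moreover have "\<exists>t. deriv u t < 0"
  proof (rule ccontr)
    assume "\<not> (\<exists>t. deriv u t < 0)"
    then have "0 \<le> deriv u t" for t by (simp add: not_less)
    with rng have "AE x in \<mu>. 0 \<le> x" by (auto elim!: eventually_mono)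
    then show False using integral_nonneg_eq_0_iff_AE[of \<mu> "\<lambda>x. x"] int mu(2) no0 by simp
  qed
  ultimately obtain p q where pq: "0 < deriv u p" "deriv u q < 0" by blast
  define c where "c = min (deriv u p) (- deriv u q)"
  define d where "d = \<bar>u p - deriv u p * p\<bar> + \<bar>u q - deriv u q * q\<bar>"
  have "c * \<bar>s\<bar> - d \<le> u s" for s
  proof (cases "0 \<le> s")
    case True
    then have "c * s \<le> deriv u p * s" unfolding c_def by (intro mult_right_mono) auto
    with True show ?thesis using tangent[of p s] by (simp add: d_def algebra_simps)
  next
    case False
    then have "c * (- s) \<le> (- deriv u q) * (- s)" unfolding c_def by (intro mult_right_mono) auto
    with False show ?thesis using tangent[of q s] by (simp add: d_def algebra_simps)
  qed
  moreover have "0 < c" using pq by (simp add: c_def)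
  ultimately show thesis using that by blast
qed

text \<open>
  Strict minimality against any other measure keeps the energy below \<open>\<infinity>\<close>; of two point masses, one
  is different from \<open>\<nu>\<close>.
\<close>

lemma free_gibbs_measure_finite_energy:
  assumes "is_free_gibbs_measure u \<nu>"
  shows "free_energy u \<nu> < \<infinity>"
proof -
  have r: "borel_prob (return borel x)" for x :: real
    by (simp add: borel_prob_def prob_space_return)
  have "emeasure (return borel (0::real)) {0} \<noteq> emeasure (return borel (1::real)) {0}" by simp
  then have "return borel (0::real) \<noteq> return borel 1" by metis
  then obtain x :: real where "return borel x \<noteq> \<nu>" by metis
  with r[of x] assms have "free_energy u \<nu> < free_energy u (return borel x)"
    by (auto simp: is_free_gibbs_measure_def)
  then show ?thesis by (rule less_le_trans) simp
qed

theorem theorem4: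
  fixes \<mu> :: "real measure" and u :: "real \<Rightarrow> real" and a b :: real
  assumes "borel_prob \<mu>"
    and "(\<integral>x. x \<partial>\<mu>) = 0"
    and "absolutely_continuous lborel \<mu>"
    and "AE x in \<mu>. x \<in> {a..b}"
    and "is_free_moment_map \<mu> u"
    and "C_k 2 u"
    and "strictly_convex u"
  shows "inj (deriv u)
    \<and> (AE x in \<mu>. x \<in> range (deriv u))
    \<and> (\<forall>x \<in> range (deriv u). legendre u x \<noteq> \<infinity>
         \<and> ((\<lambda>y. real_of_ereal (legendre u y)) has_real_derivative inv (deriv u) x) (at x))
    \<and> (\<forall>x \<in> range (deriv u). \<forall>y \<in> range (deriv u).
         (x \<noteq> y \<or> deriv (deriv u) (legendre_deriv u x) \<noteq> 0 \<longrightarrow>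
            inverse (free_diff_quot (legendre_deriv u) x y)
              = free_diff_quot (deriv u) (legendre_deriv u x) (legendre_deriv u y))
         \<and> (x \<noteq> y \<longrightarrow>
            free_diff_quot (deriv u) (legendre_deriv u x) (legendre_deriv u y)
              = (x - y) / (legendre_deriv u x - legendre_deriv u y)
            \<and> (x - y) / (legendre_deriv u x - legendre_deriv u y)
              = (x - y) / (inv (deriv u) x - inv (deriv u) y)))
    \<and> is_free_stein_kernel \<mu> (\<lambda>x. x\<^sup>2 / 2)
        (\<lambda>x y. inverse (free_diff_quot (legendre_deriv u) x y))
    \<and> is_free_stein_kernel \<mu> (\<lambda>x. x\<^sup>2 / 2)
        (\<lambda>x y. free_diff_quot (deriv u) (legendre_deriv u x) (legendre_deriv u y))
    \<and> is_free_stein_kernel \<mu> (\<lambda>x. x\<^sup>2 / 2)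
        (\<lambda>x y. (x - y) / (legendre_deriv u x - legendre_deriv u y))
    \<and> is_free_stein_kernel \<mu> (\<lambda>x. x\<^sup>2 / 2)
        (\<lambda>x y. (x - y) / (inv (deriv u) x - inv (deriv u) y))"
proof -
  note C2 = C_k_2D[OF \<open>C_k 2 u\<close>]
  interpret C: C1_strictly_convex u
    by unfold_locales (use assms(7) C2 in auto)
  have [measurable]: "deriv u \<in> borel_measurable borel" by (rule borel_measurable_continuous_onI[OF C2(3)])
  have u_meas: "u \<in> borel_measurable borel"
    by (intro borel_measurable_continuous_onI continuous_at_imp_continuous_on ballI DERIV_isCont[OF C2(1)])
  obtain \<nu> where gibbs: "is_free_gibbs_measure u \<nu>" and mu: "\<mu> = distr \<nu> borel (deriv u)"
    using assms(5) unfolding is_free_moment_map_def by blast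
  then have prob: "borel_prob \<nu>" by (simp add: is_free_gibbs_measure_def)
  then have sets[measurable_cong]: "sets \<nu> = sets borel" by (simp add: borel_prob_def)
  have rsets[measurable]: "range (deriv u) \<in> sets borel" using C.open_range by simp
  have rng: "AE x in \<mu>. x \<in> range (deriv u)"
    unfolding mu by (subst AE_distr_iff) auto
  obtain c d where "0 < c" "\<And>s. c * \<bar>s\<bar> - d \<le> u s"
    using moment_map_linear_growth[OF assms(1-4) rng C.above_tangent] by blast
  note energy = finite_free_energyD[OF prob free_gibbs_measure_finite_energy[OF gibbs] u_meas this]
  interpret N: log_gas_minimizer \<nu> u
  proof (intro log_gas_minimizer.intro log_gas_minimizer_axioms.intro)
    show "prob_space \<nu>" using prob by (simp add: borel_prob_def)
    show "AE (t, s) in \<nu> \<Otimes>\<^sub>M \<nu>. t \<noteq> s" "integrable (\<nu> \<Otimes>\<^sub>M \<nu>) (\<lambda>(t, s). ln \<bar>t - s\<bar>)"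
      "integrable \<nu> u"
      using energy by simp_all
    show "free_energy u \<nu> \<le> free_energy u \<rho>" if "borel_prob \<rho>" for \<rho>
      using gibbs that by (cases "\<rho> = \<nu>") (auto simp: is_free_gibbs_measure_def less_imp_le)
  qed (fact sets C.convex assms(6))+
  have U: "AE s in \<nu>. \<bar>deriv u s\<bar> \<le> max \<bar>a\<bar> \<bar>b\<bar>"
  proof -
    have "AE s in \<nu>. deriv u s \<in> {a..b}"
      using assms(4) unfolding mu by (subst (asm) AE_distr_iff) auto
    then show ?thesis by eventually_elim auto
  qed
  note kernel = N.stein_kernel_pushforward[OF assms(7) U, folded mu]
  have ne: "deriv u t \<noteq> deriv u s" if "t \<noteq> s" for t s
    using that injD[OF C.inj_deriv] by blast
  note [simp] = C.legendre_deriv_eq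
  have identity: "inverse (free_diff_quot (legendre_deriv u) x y)
      = free_diff_quot (deriv u) (legendre_deriv u x) (legendre_deriv u y)"
    if xy: "x \<in> range (deriv u)" "y \<in> range (deriv u)"
      and "x \<noteq> y \<or> deriv (deriv u) (legendre_deriv u x) \<noteq> 0" for x y
  proof -
    obtain t s where ts: "x = deriv u t" "y = deriv u s" using xy by blast
    show ?thesis
    proof (cases "t = s")
      case True
      then show ?thesis
        using that(3) C.deriv_legendre_deriv[OF C2(2)] by (simp add: ts free_diff_quot_def)
    next
      case False
      then show ?thesis using ne by (simp add: ts free_diff_quot_def)
    qed
  qed
  have k: "is_free_stein_kernel \<mu> (\<lambda>x. x\<^sup>2 / 2) (\<lambda>x y. inverse (free_diff_quot (legendre_deriv u) x y))"
    "is_free_stein_kernel \<mu> (\<lambda>x. x\<^sup>2 / 2)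
        (\<lambda>x y. free_diff_quot (deriv u) (legendre_deriv u x) (legendre_deriv u y))"
    "is_free_stein_kernel \<mu> (\<lambda>x. x\<^sup>2 / 2)
        (\<lambda>x y. (x - y) / (legendre_deriv u x - legendre_deriv u y))"
    "is_free_stein_kernel \<mu> (\<lambda>x. x\<^sup>2 / 2)
        (\<lambda>x y. (x - y) / (inv (deriv u) x - inv (deriv u) y))"
    by (rule kernel, use ne in \<open>simp add: free_diff_quot_def\<close>)+
  have leg: "\<forall>x \<in> range (deriv u). legendre u x \<noteq> \<infinity>
         \<and> ((\<lambda>y. real_of_ereal (legendre u y)) has_real_derivative inv (deriv u) x) (at x)"
    using C.legendre_has_derivative by (auto simp: C.legendre_deriv_u)
  have quot: "\<forall>x \<in> range (deriv u). \<forall>y \<in> range (deriv u). x \<noteq> y \<longrightarrow>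
            free_diff_quot (deriv u) (legendre_deriv u x) (legendre_deriv u y)
              = (x - y) / (legendre_deriv u x - legendre_deriv u y)
            \<and> (x - y) / (legendre_deriv u x - legendre_deriv u y)
              = (x - y) / (inv (deriv u) x - inv (deriv u) y)"
    using ne by (auto simp: free_diff_quot_def)
  show ?thesis
    by (intro conjI C.inj_deriv rng leg k) (use quot identity in simp)
qed

end
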